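(* Let $n\geq 2$ be an even integer and let $p$ be a prime. (i) If $p\equiv\pm1\pmod n$, $p>n+1$, and $c_1\neq c_2$ are elements of $\mathbb{F}_p$ such that $T_n(x)-c_1$ and $T_n(x)-c_2$ both split completely over $\mathbb{F}_p$, then letting $A$ and $B$ be the multisets of roots (counted with multiplicity) over $\mathbb{F}_p$ of $T_n(x)-c_1$ and $T_n(x)-c_2$ respectively, the pair $(A,B)$ is a symmetric ideal Prouhet–Tarry–Escott solution of size $n$ in $\mathbb{F}_p$. (ii) If $p\equiv 1\pmod n$, let $a\in\mathbb{F}_p$ have multiplicative order $n$ and set $r=(p-1)/n$. Then there exist $r$ distinct integers $s\in[0,p-1)$, including $s=0$, such that $A=\{1,a,\ldots,a^{n-1}\}$ and $B=sA$ form a symmetric ideal Prouhet–Tarry–Escott solution of size $n$ in $\mathbb{F}_p$.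
   Context: $T_n(x)\in\mathbb{Z}[x]$ denotes the $n$th Chebyshev polynomial of the first kind, defined by $T_n(\cos\theta)=\cos(n\theta)$, reduced modulo $p$. An ideal Prouhet–Tarry–Escott (PTE) solution of size $n$ in $\mathbb{F}_p$ is a pair of disjoint multisets $A=\{a_1,\ldots,a_n\}$, $B=\{b_1,\ldots,b_n\}$ of elements of $\mathbb{F}_p$ (no element of $A$ equals an element of $B$) such that $\sum_{i=1}^n a_i^k=\sum_{i=1}^n b_i^k$ in $\mathbb{F}_p$ for all $1\leq k\leq n-1$. For even $n$, such a solution is called symmetric if $A=-A$ and $B=-B$ as multisets. For $s\in\mathbb{F}_p$, $sA$ denotes the multiset $\{sa: a\in A\}$ (so $0\cdot A$ is the multiset consisting of $n$ copies of $0$). *)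

theory Defs
  imports
    "HOL-Analysis.Analysis"
    "HOL-Library.Multiset"
    "HOL-Computational_Algebra.Polynomial"
    "HOL-Number_Theory.Cong"
    "Berlekamp_Zassenhaus.Finite_Field"
begin

definition chebyshev_T :: "nat \<Rightarrow> int poly" where
  "chebyshev_T n =
     (THE T. \<forall>\<theta>::real. poly (map_poly of_int T) (cos \<theta>) = cos (real n * \<theta>))"

lemma chebyshev_T_exists:
  "\<exists>T::int poly. \<forall>\<theta>::real. poly (map_poly of_int T) (cos \<theta>) = cos (real n * \<theta>)"
proof (induction n rule: induct_nat_012)
  case 0
  show ?case by (rule exI[of _ 1]) simp
next
  case 1
  show ?case by (rule exI[of _ "[:0, 1:]"]) (simp add: map_poly_pCons)
next
  case (ge2 n)
  obtain P :: "int poly" where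
    P: "\<And>\<theta>::real. poly (map_poly of_int P) (cos \<theta>) = cos (real n * \<theta>)"
    using ge2.IH(1) by blast
  obtain Q :: "int poly" where
    Q: "\<And>\<theta>::real. poly (map_poly of_int Q) (cos \<theta>) = cos (real (Suc n) * \<theta>)"
    using ge2.IH(2) by blast
  have "poly (map_poly of_int ([:0, 2:] * Q - P)) (cos \<theta>) = cos (real (Suc (Suc n)) * \<theta>)"
    for \<theta> :: real
  proof -
    have "poly (map_poly of_int ([:0, 2:] * Q - P)) (cos \<theta>)
        = 2 * cos \<theta> * cos (real (Suc n) * \<theta>) - cos (real n * \<theta>)"
      by (simp only: of_int_poly_hom.hom_mult of_int_poly_hom.hom_minus poly_mult poly_diff P Q)
        (simp add: map_poly_pCons)
    moreover have "cos (real (Suc (Suc n)) * \<theta>) = cos (real (Suc n) * \<theta> + \<theta>)"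
      "cos (real n * \<theta>) = cos (real (Suc n) * \<theta> - \<theta>)"
      by (simp_all add: algebra_simps)
    ultimately show ?thesis by (simp only: cos_add cos_diff) simp
  qed
  then show ?case by blast
qed

lemma chebyshev_T_unique:
  fixes S T :: "int poly"
  assumes "\<forall>\<theta>::real. poly (map_poly of_int S) (cos \<theta>) = cos (real n * \<theta>)"
    and "\<forall>\<theta>::real. poly (map_poly of_int T) (cos \<theta>) = cos (real n * \<theta>)"
  shows "S = T"
proof -
  let ?D = "map_poly of_int S - map_poly of_int T :: real poly"
  have "{-1..1} \<subseteq> {x. poly ?D x = 0}"
  proof
    fix x :: real assume "x \<in> {-1..1}"
    then have "cos (arccos x) = x" by (simp add: cos_arccos)
    then show "x \<in> {x. poly ?D x = 0}"
      using assms(1)[rule_format, of "arccos x"] assms(2)[rule_format, of "arccos x"] by simp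
  qed
  then have "infinite {x. poly ?D x = 0}"
    using infinite_Icc[of "-1" "1::real"] by (meson finite_subset less_numeral_extra(1) neg_less_0_iff_less order.strict_trans)
  then have "?D = 0" using poly_roots_finite by blast
  then have "(map_poly of_int S :: real poly) = map_poly of_int T" by simp
  then show "S = T" by (simp add: of_int_poly_hom.eq_iff)
qed

lemma poly_chebyshev_T_cos:
  "poly (map_poly of_int (chebyshev_T n)) (cos \<theta>) = cos (real n * (\<theta>::real))"
proof -
  have "\<exists>!T::int poly. \<forall>\<theta>::real. poly (map_poly of_int T) (cos \<theta>) = cos (real n * \<theta>)"
    using chebyshev_T_exists chebyshev_T_unique by blast
  from theI'[OF this] show ?thesis by (simp add: chebyshev_T_def)
qed

definition splits_completely :: "'a::field poly \<Rightarrow> bool" where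
  "splits_completely f \<longleftrightarrow> (\<exists>c R. f = Polynomial.smult c (\<Prod>x\<in>#R. [:-x, 1:]))"

text \<open>The value 0 encodes infinite order.\<close>
definition mult_order :: "'a::field \<Rightarrow> nat" where
  "mult_order a = (if \<exists>m>0. a ^ m = 1 then LEAST m. m > 0 \<and> a ^ m = 1 else 0)"

definition ideal_PTE :: "nat \<Rightarrow> 'a::comm_ring_1 multiset \<Rightarrow> 'a multiset \<Rightarrow> bool" where
  "ideal_PTE n A B \<longleftrightarrow>
     size A = n \<and> size B = n \<and> set_mset A \<inter> set_mset B = {} \<and>
     (\<forall>k\<in>{1..n-1}. (\<Sum>a\<in>#A. a ^ k) = (\<Sum>b\<in>#B. b ^ k))"

definition symmetric_ideal_PTE :: "nat \<Rightarrow> 'a::comm_ring_1 multiset \<Rightarrow> 'a multiset \<Rightarrow> bool" where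
  "symmetric_ideal_PTE n A B \<longleftrightarrow>
     even n \<and> ideal_PTE n A B \<and> image_mset uminus A = A \<and> image_mset uminus B = B"

definition scale_mset :: "'a::comm_ring_1 \<Rightarrow> 'a multiset \<Rightarrow> 'a multiset" where
  "scale_mset s A = {#s * a. a \<in># A#}"

end

theory Submission
  imports Defs
begin

hide_const (open) up_ring.coeff Module.smult

(* As a simp rule it rewrites even 0 * sum_mset M and blocks mult_zero_left. *)
declare mult_hom.hom_sum_mset [simp del]

text \<open>
  In (i) the two polynomials differ by a constant, so all their coefficients except the constant
  ones agree; Newton's identities express the power sums of degree less than \<open>n\<close> of the roots
  through exactly these coefficients. Disjointness holds because a common root would force
  \<open>c\<^sub>1 = c\<^sub>2\<close>, and symmetry holds because \<open>T\<^sub>n\<close> is even for even \<open>n\<close>.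
  In (ii) all power sums of degrees \<open>1, \<dots>, n - 1\<close> over \<open>A\<close>, and hence over \<open>s A\<close>, vanish, so only
  disjointness is at stake, which excludes the \<open>n\<close> values \<open>s \<in> A\<close>. One of these is
  \<open>p - 1\<close>, so \<open>p - n \<ge> (p - 1) / n\<close> admissible values remain in \<open>[0, p - 1)\<close>.
\<close>

subsection \<open>Newton's identities\<close>

text \<open>Horner's scheme: each quotient coefficient on division by \<open>X - a\<close> is a tail
  of \<open>f\<close> evaluated at \<open>a\<close>. The bound \<open>N\<close> may exceed the
  degree, so one summation range serves all coefficients \<open>m\<close>.\<close>

lemma coeff_synthetic_div:
  fixes f :: "'a::comm_semiring_1 poly"
  assumes "degree f \<le> N"
  shows "coeff (synthetic_div f a) m = (\<Sum>j<N. coeff f (Suc m + j) * a ^ j)"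
  using assms
proof (induction f arbitrary: m)
  case 0
  then show ?case by simp
next
  case (pCons c f)
  show ?case
  proof (cases "f = 0")
    case True
    then show ?thesis by simp
  next
    case False
    then have deg: "degree f < N" using pCons.prems by simp
    show ?thesis
    proof (cases m)
      case 0
      have "poly f a = (\<Sum>i\<le>degree f. coeff f i * a ^ i)" by (rule poly_altdef)
      also have "\<dots> = (\<Sum>i<N. coeff f i * a ^ i)"
        using deg by (intro sum.mono_neutral_left) (auto simp: coeff_eq_0)
      finally show ?thesis using 0 by simp
    next
      case (Suc m')
      then show ?thesis using pCons.IH[of m'] deg by simp
    qed
  qed
qed

lemma synthetic_div_prod_mset:
  fixes A :: "'a::idom multiset"
  assumes "a \<in># A"
  shows "synthetic_div (\<Prod>x\<in>#A. [:-x, 1:]) a = (\<Prod>x\<in>#A - {#a#}. [:-x, 1:])"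
proof -
  let ?q = "\<Prod>x\<in>#A - {#a#}. [:-x, 1:]"
  have "A = add_mset a (A - {#a#})" using assms by simp
  then have "(\<Prod>x\<in>#A. [:-x, 1:]) = [:-a, 1:] * ?q"
    by (metis image_mset_add_mset prod_mset.add_mset)
  \<comment> \<open>The shape \<open>f + smult a q = pCons r q\<close> expresses division by
    \<open>X - a\<close> with remainder \<open>r\<close>; here \<open>r = 0\<close> because
    \<open>a\<close> is a root.\<close>
  then have "(\<Prod>x\<in>#A. [:-x, 1:]) + smult a ?q = pCons 0 ?q" by simp
  from synthetic_div_unique[OF this] show ?thesis by simp
qed

lemma pderiv_prod_mset_linear:
  fixes A :: "'a::idom multiset"
  shows "pderiv (\<Prod>x\<in>#A. [:-x, 1:]) = (\<Sum>a\<in>#A. \<Prod>x\<in>#A - {#a#}. [:-x, 1:])"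
proof (induction A)
  case empty
  then show ?case by simp
next
  case (add y A)
  have "(\<Sum>a\<in>#A. \<Prod>x\<in>#add_mset y A - {#a#}. [:-x, 1:])
      = (\<Sum>a\<in>#A. [:-y, 1:] * (\<Prod>x\<in>#A - {#a#}. [:-x, 1:]))"
  proof (intro arg_cong[of _ _ sum_mset] image_mset_cong)
    fix a assume "a \<in># A"
    \<comment> \<open>This includes the case \<open>a = y\<close>, where \<open>y\<close> already
      occurs in \<open>A\<close>.\<close>
    then have "add_mset y A - {#a#} = add_mset y (A - {#a#})" by simp
    then show "(\<Prod>x\<in>#add_mset y A - {#a#}. [:-x, 1:])
        = [:-y, 1:] * (\<Prod>x\<in>#A - {#a#}. [:-x, 1:])"
      by (simp only: image_mset_add_mset prod_mset.add_mset)
  qed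
  also have "\<dots> = [:-y, 1:] * pderiv (\<Prod>x\<in>#A. [:-x, 1:])"
    by (simp only: add.IH sum_mset_distrib_left)
  finally show ?case
    by (simp only: image_mset_add_mset prod_mset.add_mset sum_mset.add_mset pderiv_mult
        add_mset_remove_trivial) (simp add: pderiv_pCons algebra_simps)
qed

lemma degree_prod_mset_linear:
  fixes A :: "'a::idom multiset"
  shows "degree (\<Prod>x\<in>#A. [:-x, 1:]) = size A"
    and "lead_coeff (\<Prod>x\<in>#A. [:-x, 1:]) = 1"
proof -
  have "degree (\<Prod>x\<in>#A. [:-x, 1:]) = size A \<and> lead_coeff (\<Prod>x\<in>#A. [:-x, 1:]) = 1"
  proof (induction A)
    case (add y A)
    then have "(\<Prod>x\<in>#A. [:-x, 1:]) \<noteq> 0" by auto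
    then have "degree ([:-y, 1:] * (\<Prod>x\<in>#A. [:-x, 1:])) = Suc (size A)"
      using add by (subst degree_mult_eq) auto
    moreover have "lead_coeff ([:-y, 1:] * (\<Prod>x\<in>#A. [:-x, 1:])) = 1"
      using add by (simp only: lead_coeff_mult) auto
    ultimately show ?case by (simp only: image_mset_add_mset prod_mset.add_mset size_add_mset)
  qed simp
  then show "degree (\<Prod>x\<in>#A. [:-x, 1:]) = size A"
    and "lead_coeff (\<Prod>x\<in>#A. [:-x, 1:]) = 1" by auto
qed

lemma coeff_sum_mset: "coeff (\<Sum>a\<in>#A. f a) m = (\<Sum>a\<in>#A. coeff (f a) m)"
  by (induction A) auto

lemma sum_mset_sum_swap:
  fixes f :: "'a \<Rightarrow> 'b \<Rightarrow> 'c::comm_monoid_add"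
  shows "(\<Sum>a\<in>#A. \<Sum>j\<in>J. f a j) = (\<Sum>j\<in>J. \<Sum>a\<in>#A. f a j)"
  by (induction A) (auto simp: sum.distrib)

text \<open>Compares the coefficients of \<open>X^m\<close> in
  \<open>f' = \<Sum> f / (X - a)\<close>, the quotients being expanded by Horner's scheme. No
  division by integers occurs, so positive characteristic does no harm.\<close>

lemma newton_identity:
  fixes A :: "'a::idom multiset"
  defines "f \<equiv> \<Prod>x\<in>#A. [:-x, 1:]"
  shows "(\<Sum>j<size A. coeff f (Suc m + j) * (\<Sum>a\<in>#A. a ^ j)) = of_nat (Suc m) * coeff f (Suc m)"
proof -
  have "of_nat (Suc m) * coeff f (Suc m) = coeff (pderiv f) m"
    by (simp add: coeff_pderiv)
  also have "pderiv f = (\<Sum>a\<in>#A. synthetic_div f a)"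
    unfolding f_def pderiv_prod_mset_linear
    by (intro arg_cong[of _ _ sum_mset] image_mset_cong) (simp add: synthetic_div_prod_mset)
  also have "coeff \<dots> m = (\<Sum>a\<in>#A. \<Sum>j<size A. coeff f (Suc m + j) * a ^ j)"
    unfolding coeff_sum_mset
    by (intro arg_cong[of _ _ sum_mset] image_mset_cong coeff_synthetic_div)
      (simp add: f_def degree_prod_mset_linear)
  also have "\<dots> = (\<Sum>j<size A. coeff f (Suc m + j) * (\<Sum>a\<in>#A. a ^ j))"
    by (simp add: sum_mset_sum_swap sum_mset_distrib_left)
  finally show ?thesis by simp
qed

text \<open>In Newton's identity for \<open>Suc m = size A - k\<close>, the terms with
  \<open>j > k\<close> have coefficients beyond the degree and vanish. The term \<open>j = k\<close>
  carries the leading coefficient 1, so the \<open>k\<close>-th power sum can be isolated without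
  dividing.\<close>

lemma power_sum_recurrence:
  fixes A :: "'a::idom multiset"
  defines "f \<equiv> \<Prod>x\<in>#A. [:-x, 1:]"
  assumes "k < size A"
  shows "(\<Sum>a\<in>#A. a ^ k) = of_nat (size A - k) * coeff f (size A - k)
           - (\<Sum>j<k. coeff f (size A - k + j) * (\<Sum>a\<in>#A. a ^ j))"
proof -
  let ?p = "\<lambda>j. \<Sum>a\<in>#A. a ^ j" and ?n = "size A"
  obtain m where m: "?n - k = Suc m" using assms(2) by (metis Suc_diff_Suc)
  have deg: "degree f = ?n" "coeff f ?n = 1"
    using degree_prod_mset_linear[of A] by (simp_all add: f_def)
  have "of_nat (?n - k) * coeff f (?n - k) = (\<Sum>j<?n. coeff f (?n - k + j) * ?p j)"
    using newton_identity[of A m] unfolding f_def m by simp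
  also have "\<dots> = (\<Sum>j<Suc k. coeff f (?n - k + j) * ?p j)"
    using assms(2) deg by (intro sum.mono_neutral_right) (auto simp: coeff_eq_0)
  also have "\<dots> = (\<Sum>j<k. coeff f (?n - k + j) * ?p j) + ?p k"
    using assms(2) deg by simp
  finally show ?thesis by simp
qed

text \<open>Strong induction on \<open>k\<close>: since \<open>k < size A\<close>, the recurrence
  involves only coefficients of positive index \<open>size A - k + j\<close>, never the constant
  term.\<close>

lemma power_sums_eq:
  fixes A B :: "'a::idom multiset"
  assumes size: "size B = size A"
    and coeff: "\<And>j. j > 0 \<Longrightarrow>
      coeff (\<Prod>x\<in>#A. [:-x, 1:]) j = coeff (\<Prod>x\<in>#B. [:-x, 1:]) j"
    and "k < size A"
  shows "(\<Sum>a\<in>#A. a ^ k) = (\<Sum>b\<in>#B. b ^ k)"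
  using assms(3)
proof (induction k rule: less_induct)
  case (less k)
  have "(\<Sum>j<k. coeff (\<Prod>x\<in>#A. [:-x, 1:]) (size A - k + j) * (\<Sum>a\<in>#A. a ^ j))
      = (\<Sum>j<k. coeff (\<Prod>x\<in>#B. [:-x, 1:]) (size A - k + j) * (\<Sum>b\<in>#B. b ^ j))"
    using less by (intro sum.cong refl arg_cong2[of _ _ _ _ "(*)"] coeff) auto
  then show ?case
    using less.prems power_sum_recurrence[of k A] power_sum_recurrence[of k B] size
      coeff[of "size A - k"] by simp
qed

subsection \<open>Chebyshev polynomials\<close>

text \<open>Reduces identities between Chebyshev polynomials to trigonometric ones.\<close>

lemma chebyshev_T_eqI:
  assumes "\<And>\<theta>::real. poly (map_poly of_int T) (cos \<theta>) = cos (real n * \<theta>)"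
  shows "chebyshev_T n = T"
  using assms poly_chebyshev_T_cos by (intro chebyshev_T_unique) auto

lemma chebyshev_T_0: "chebyshev_T 0 = 1"
  by (rule chebyshev_T_eqI) simp

lemma chebyshev_T_1: "chebyshev_T 1 = [:0, 1:]"
  by (rule chebyshev_T_eqI) (simp add: map_poly_pCons)

lemma chebyshev_T_Suc_Suc:
  "chebyshev_T (Suc (Suc n)) = [:0, 2:] * chebyshev_T (Suc n) - chebyshev_T n"
proof (rule chebyshev_T_eqI)
  fix \<theta> :: real
  have "poly (map_poly of_int ([:0, 2:] * chebyshev_T (Suc n) - chebyshev_T n)) (cos \<theta>)
      = 2 * cos \<theta> * cos (real (Suc n) * \<theta>) - cos (real n * \<theta>)"
    by (simp only: of_int_poly_hom.hom_mult of_int_poly_hom.hom_minus poly_mult poly_diff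
        poly_chebyshev_T_cos) (simp add: map_poly_pCons)
  moreover have "cos (real (Suc (Suc n)) * \<theta>) = cos (real (Suc n) * \<theta> + \<theta>)"
    "cos (real n * \<theta>) = cos (real (Suc n) * \<theta> - \<theta>)"
    by (simp_all add: algebra_simps)
  ultimately show "poly (map_poly of_int ([:0, 2:] * chebyshev_T (Suc n) - chebyshev_T n)) (cos \<theta>)
      = cos (real (Suc (Suc n)) * \<theta>)"
    by (simp only: cos_add cos_diff) simp
qed

lemma degree_chebyshev_T_le: "degree (chebyshev_T n) \<le> n"
proof (induction n rule: induct_nat_012)
  case (ge2 n)
  have "degree ([:0, 2:] * chebyshev_T (Suc n)) \<le> Suc (Suc n)"
    using ge2 by (intro order.trans[OF degree_mult_le]) auto
  then show ?case using ge2 unfolding chebyshev_T_Suc_Suc by (intro degree_diff_le) auto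
qed (simp_all add: chebyshev_T_0 chebyshev_T_1[unfolded One_nat_def])

text \<open>The leading coefficient is a power of 2, so the degree survives reduction modulo an odd
  prime.\<close>

lemma coeff_chebyshev_T_Suc: "coeff (chebyshev_T (Suc n)) (Suc n) = 2 ^ n"
proof (induction n)
  case 0
  then show ?case by (simp add: chebyshev_T_1[unfolded One_nat_def])
next
  case (Suc n)
  have "coeff (chebyshev_T n) (Suc (Suc n)) = 0"
    using degree_chebyshev_T_le[of n] by (simp add: coeff_eq_0)
  then show ?case using Suc unfolding chebyshev_T_Suc_Suc by (simp add: mult_pCons_left)
qed

text \<open>Replacing \<open>x\<close> by \<open>-x\<close> shifts \<theta> by pi, and for even
  \<open>n\<close> this shifts \<open>n * \<theta>\<close> by a multiple of the period
  \<open>2 * pi\<close>.\<close>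

lemma chebyshev_T_pcompose_uminus:
  assumes "even n"
  shows "pcompose (chebyshev_T n) [:0, -1:] = chebyshev_T n"
proof (rule chebyshev_T_eqI[symmetric])
  fix \<theta> :: real
  obtain m where m: "n = 2 * m" using assms by blast
  have "poly (map_poly of_int (pcompose (chebyshev_T n) [:0, -1:])) (cos \<theta>)
      = poly (map_poly of_int (chebyshev_T n)) (cos (\<theta> + pi))"
    by (simp add: of_int_hom.map_poly_pcompose poly_pcompose map_poly_pCons)
  also have "\<dots> = cos (real n * \<theta> + 2 * of_nat m * pi)"
    unfolding poly_chebyshev_T_cos by (simp add: m algebra_simps)
  also have "\<dots> = cos (real n * \<theta>)"
    by (simp add: cos_add)
  finally show "poly (map_poly of_int (pcompose (chebyshev_T n) [:0, -1:])) (cos \<theta>)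
      = cos (real n * \<theta>)" .
qed

subsection \<open>Polynomials that split completely\<close>

lemma proots_prod_mset_linear:
  fixes R :: "'a::idom multiset"
  shows "proots (\<Prod>x\<in>#R. [:-x, 1:]) = R"
proof (induction R)
  case (add y R)
  have "(\<Prod>x\<in>#R. [:-x, 1:]) \<noteq> 0" using degree_prod_mset_linear(2)[of R] by auto
  then show ?case using add
    by (simp only: image_mset_add_mset prod_mset.add_mset) (subst proots_mult, auto)
qed simp

text \<open>The witnesses of a nonzero split polynomial are forced: comparing roots and leading
  coefficients determines both. For \<open>f = 0\<close> the leading coefficient 0 makes the right
  side vanish too.\<close>

lemma splits_completely_conv_proots:
  assumes "splits_completely f"
  shows "f = smult (lead_coeff f) (\<Prod>x\<in>#proots f. [:-x, 1:])"
proof (cases "f = 0")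
  case False
  from assms obtain c R where f: "f = smult c (\<Prod>x\<in>#R. [:-x, 1:])"
    by (auto simp: splits_completely_def)
  then have "c \<noteq> 0" using False by auto
  then have "proots f = R" "lead_coeff f = c"
    using degree_prod_mset_linear(2)[of R] by (simp_all add: f proots_prod_mset_linear)
  then show ?thesis using f by metis
qed simp

lemma size_proots_splits_completely:
  assumes "splits_completely f"
  shows "size (proots f) = degree f"
proof (cases "f = 0")
  case False
  have "degree f = degree (smult (lead_coeff f) (\<Prod>x\<in>#proots f. [:-x, 1:]))"
    using splits_completely_conv_proots[OF assms] by simp
  then show ?thesis using False degree_prod_mset_linear(1)[of "proots f"] by simp
qed simp

lemma pcompose_prod_mset_linear_uminus:
  fixes R :: "'a::idom multiset"
  shows "pcompose (\<Prod>x\<in>#R. [:-x, 1:]) [:0, -1:]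
    = smult ((-1) ^ size R) (\<Prod>x\<in>#image_mset uminus R. [:-x, 1:])"
proof (induction R)
  case (add y R)
  have "pcompose [:-y, 1:] [:0, -1:] = smult (-1) [:y, 1:]"
    by (simp add: pcompose_pCons)
  then show ?case using add
    by (simp only: image_mset_add_mset prod_mset.add_mset pcompose_mult size_add_mset power_Suc
        mult_smult_left mult_smult_right smult_smult minus_minus mult.commute)
qed (simp add: one_pCons pcompose_pCons)

text \<open>Substituting \<open>-X\<close> negates the roots and contributes only a unit
  \<plusminus>1, which does not affect \<open>proots\<close>.\<close>

lemma image_uminus_proots:
  fixes f :: "'a::field poly"
  assumes split: "splits_completely f" and even: "pcompose f [:0, -1:] = f"
  shows "image_mset uminus (proots f) = proots f"
proof (cases "f = 0")
  case False
  let ?R = "proots f" and ?c = "lead_coeff f"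
  have "f = pcompose (smult ?c (\<Prod>x\<in>#?R. [:-x, 1:])) [:0, -1:]"
    using even splits_completely_conv_proots[OF split] by simp
  also have "\<dots> = smult (?c * (-1) ^ size ?R) (\<Prod>x\<in>#image_mset uminus ?R. [:-x, 1:])"
    by (simp only: pcompose_smult pcompose_prod_mset_linear_uminus smult_smult)
  finally have "proots f = proots \<dots>" by (rule arg_cong)
  also have "\<dots> = proots (\<Prod>x\<in>#image_mset uminus ?R. [:-x, 1:])"
    using False by (intro proots_smult) simp
  finally show ?thesis by (simp only: proots_prod_mset_linear)
qed simp

text \<open>Isolates what part (i) takes from the Chebyshev polynomial: its degree \<open>n\<close>
  and its invariance under \<open>x\<close> to \<open>-x\<close>.\<close>

lemma symmetric_ideal_PTE_proots:
  fixes g :: "'a::field poly"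
  assumes "even n" "n > 0" and deg: "degree g = n" and even: "pcompose g [:0, -1:] = g"
    and "c\<^sub>1 \<noteq> c\<^sub>2"
    and split: "splits_completely (g - [:c\<^sub>1:])" "splits_completely (g - [:c\<^sub>2:])"
  shows "symmetric_ideal_PTE n (proots (g - [:c\<^sub>1:])) (proots (g - [:c\<^sub>2:]))"
proof -
  have deg': "degree (g - [:c:]) = n" for c
    using deg \<open>n > 0\<close> degree_add_eq_left[of "- [:c:]" g] by (simp del: minus_pCons)
  have coeff': "coeff (g - [:c:]) j = coeff g j" if "j > 0" for c j
    using that by (cases j) auto
  have lead: "lead_coeff (g - [:c:]) = lead_coeff g" for c
    using coeff'[of n c] deg deg' \<open>n > 0\<close> by simp
  have ne: "g - [:c:] \<noteq> 0" for c using deg'[of c] \<open>n > 0\<close> by auto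
  have lg: "lead_coeff g \<noteq> 0" using deg \<open>n > 0\<close> by auto
  have size: "size (proots (g - [:c:])) = n" if "splits_completely (g - [:c:])" for c
    using size_proots_splits_completely[OF that] deg' by simp
  have sym: "image_mset uminus (proots (g - [:c:])) = proots (g - [:c:])"
    if "splits_completely (g - [:c:])" for c
    using that by (rule image_uminus_proots) (simp add: pcompose_diff even)
  \<comment> \<open>The right side is free of \<open>c\<close>, so the two monic products agree in
    all positive degrees.\<close>
  have cf: "coeff (\<Prod>x\<in>#proots (g - [:c:]). [:-x, 1:]) j = coeff g j / lead_coeff g"
    if "splits_completely (g - [:c:])" "j > 0" for c j
  proof -
    have "coeff g j = coeff (smult (lead_coeff g) (\<Prod>x\<in>#proots (g - [:c:]). [:-x, 1:])) j"
      using splits_completely_conv_proots[OF that(1)] coeff'[OF that(2), of c] lead[of c] by simp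
    then show ?thesis using lg by simp
  qed
  have "(\<Sum>a\<in>#proots (g - [:c\<^sub>1:]). a ^ k) = (\<Sum>b\<in>#proots (g - [:c\<^sub>2:]). b ^ k)" if "k < n" for k
    using that split by (intro power_sums_eq) (simp_all add: size cf)
  \<comment> \<open>At a common root, \<open>g\<close> would take both values
    \<open>c\<^sub>1\<close> and \<open>c\<^sub>2\<close>.\<close>
  moreover have "set_mset (proots (g - [:c\<^sub>1:])) \<inter> set_mset (proots (g - [:c\<^sub>2:])) = {}"
    using \<open>c\<^sub>1 \<noteq> c\<^sub>2\<close> ne by auto
  ultimately show ?thesis
    using \<open>even n\<close> \<open>n > 0\<close> size sym split unfolding symmetric_ideal_PTE_def ideal_PTE_def by auto
qed

subsection \<open>Roots of unity\<close>

lemma mult_orderD: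
  assumes "mult_order a = n" "n > 0"
  shows "a ^ n = 1" and "\<And>m. 0 < m \<Longrightarrow> m < n \<Longrightarrow> a ^ m \<noteq> 1"
proof -
  let ?P = "\<lambda>m. m > 0 \<and> a ^ m = 1"
  have ex: "\<exists>m. ?P m" and n: "n = (LEAST m. ?P m)"
    using assms by (auto simp: mult_order_def split: if_splits)
  show "a ^ n = 1" using LeastI_ex[OF ex] n by simp
  show "a ^ m \<noteq> 1" if "0 < m" "m < n" for m
    using not_less_Least[of m ?P] that n by simp
qed

context
  fixes a :: "'a::field" and n :: nat
  assumes order: "mult_order a = n" and n_pos: "n > 0" and n_even: "even n"
begin

lemma inj_on_power_mult_order: "inj_on (\<lambda>i. a ^ i) {0..<n}"
proof (rule linorder_inj_onI)
  fix i j assume ij: "i < j" "i \<in> {0..<n}" "j \<in> {0..<n}"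
  have "a \<noteq> 0" using mult_orderD(1)[OF order n_pos] n_pos by (auto simp: power_0_left)
  moreover have "a ^ (j - i) \<noteq> 1" using ij by (intro mult_orderD(2)[OF order n_pos]) auto
  moreover have "a ^ j = a ^ i * a ^ (j - i)" using ij by (simp flip: power_add)
  ultimately show "a ^ i \<noteq> a ^ j" by auto
qed auto

text \<open>A square root of 1 in a field is 1 or -1, and minimality of the order excludes 1. Thus
  the powers of \<open>a\<close> contain -1, which yields the symmetry.\<close>

lemma power_half_mult_order: "a ^ (n div 2) = -1"
proof -
  have "(a ^ (n div 2))\<^sup>2 = 1"
    using n_even mult_orderD(1)[OF order n_pos] by (simp flip: power_mult)
  moreover have "a ^ (n div 2) \<noteq> 1"
    using n_even n_pos by (intro mult_orderD(2)[OF order n_pos]) auto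
  ultimately show ?thesis by (simp add: power2_eq_1_iff)
qed

lemma mult_mem_powers:
  assumes "x \<in> (\<lambda>i. a ^ i) ` {0..<n}"
  shows "a ^ j * x \<in> (\<lambda>i. a ^ i) ` {0..<n}"
proof -
  obtain i where i: "x = a ^ i" using assms by blast
  have "a ^ (j + i) = a ^ (n * ((j + i) div n) + (j + i) mod n)" by simp
  also have "\<dots> = a ^ ((j + i) mod n)"
    unfolding power_add power_mult mult_orderD(1)[OF order n_pos] by simp
  finally show ?thesis using n_pos by (auto simp: i power_add)
qed

lemma one_mem_powers: "1 \<in> (\<lambda>i. a ^ i) ` {0..<n}"
  using n_pos by (intro image_eqI[of _ _ 0]) auto

lemma uminus_mem_powers:
  assumes "x \<in> (\<lambda>i. a ^ i) ` {0..<n}"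
  shows "- x \<in> (\<lambda>i. a ^ i) ` {0..<n}"
  using mult_mem_powers[OF assms, of "n div 2"] by (simp add: power_half_mult_order)

text \<open>The powers are distinct, so the multiset is a set; negation is an injective self-map of
  this finite set, hence onto.\<close>

lemma image_uminus_powers:
  "image_mset uminus {#a ^ i. i \<in># mset_set {0..<n}#} = {#a ^ i. i \<in># mset_set {0..<n}#}"
proof -
  let ?G = "(\<lambda>i. a ^ i) ` {0..<n}"
  have "{#a ^ i. i \<in># mset_set {0..<n}#} = mset_set ?G"
    by (rule image_mset_mset_set[OF inj_on_power_mult_order])
  moreover have "image_mset uminus (mset_set ?G) = mset_set (uminus ` ?G)"
    by (rule image_mset_mset_set) (auto simp: inj_on_def)
  moreover have "uminus ` ?G = ?G"
    using uminus_mem_powers by (intro endo_inj_surj) (auto simp: inj_on_def)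
  ultimately show ?thesis by simp
qed

text \<open>A geometric sum with ratio \<open>a ^ k\<close>, which differs from 1 but has
  \<open>n\<close>-th power 1.\<close>

lemma power_sum_powers:
  assumes "0 < k" "k < n"
  shows "(\<Sum>x\<in>#{#a ^ i. i \<in># mset_set {0..<n}#}. x ^ k) = 0"
proof -
  have "(\<Sum>x\<in>#{#a ^ i. i \<in># mset_set {0..<n}#}. x ^ k) = (\<Sum>i<n. (a ^ k) ^ i)"
    by (simp add: image_mset.compositionality o_def sum_unfold_sum_mset atLeast0LessThan
        mult.commute flip: power_mult)
  also have "\<dots> = ((a ^ k) ^ n - 1) / (a ^ k - 1)"
    using assms mult_orderD(2)[OF order n_pos] by (intro geometric_sum) auto
  also have "(a ^ k) ^ n = 1"
    using mult_orderD(1)[OF order n_pos] by (metis power_commutes power_mult mult.commute power_one)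
  finally show ?thesis by simp
qed

text \<open>Scaling multiplies the \<open>k\<close>-th power sum by \<open>s ^ k\<close>, so it
  stays 0. The case \<open>s = 0\<close>, with \<open>n\<close> copies of 0, is included.\<close>

lemma symmetric_ideal_PTE_powers:
  assumes "s \<notin> (\<lambda>i. a ^ i) ` {0..<n}"
  defines "A \<equiv> {#a ^ i. i \<in># mset_set {0..<n}#}"
  shows "symmetric_ideal_PTE n A (scale_mset s A)"
proof -
  have disj: "a ^ i \<noteq> s * a ^ j" if "i < n" "j < n" for i j
  proof
    assume eq: "a ^ i = s * a ^ j"
    have "a ^ (n - j) * a ^ j = 1"
      using that mult_orderD(1)[OF order n_pos] by (simp flip: power_add)
    \<comment> \<open>A common element would place \<open>s\<close> itself among the powers of
      \<open>a\<close>.\<close>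
    then have "s = a ^ (n - j) * a ^ i" using eq by (simp add: mult.left_commute)
    then show False using assms(1) mult_mem_powers[of "a ^ i" "n - j"] that by auto
  qed
  have "(\<Sum>b\<in>#scale_mset s A. b ^ k) = s ^ k * (\<Sum>x\<in>#A. x ^ k)" for k
    by (simp add: scale_mset_def image_mset.compositionality o_def power_mult_distrib
        sum_mset_distrib_left)
  then have "(\<Sum>b\<in>#A. b ^ k) = (\<Sum>b\<in>#scale_mset s A. b ^ k)" if "0 < k" "k < n" for k
    using power_sum_powers[OF that] by (simp add: A_def)
  moreover have "set_mset A \<inter> set_mset (scale_mset s A) = {}"
    using disj by (auto simp: A_def scale_mset_def)
  moreover have sym: "image_mset uminus A = A"
    unfolding A_def by (rule image_uminus_powers)
  moreover have "image_mset uminus (scale_mset s A) = scale_mset s (image_mset uminus A)"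
    by (simp add: scale_mset_def image_mset.compositionality o_def)
  moreover have "size A = n" "size (scale_mset s A) = n"
    by (simp_all add: A_def scale_mset_def)
  ultimately show ?thesis
    using n_even unfolding symmetric_ideal_PTE_def ideal_PTE_def by auto
qed

end

section \<open>Counting the admissible scaling factors\<close>

lemma inj_on_of_int_mod_ring:
  "inj_on (of_int :: int \<Rightarrow> 'p::prime_card mod_ring) {0..<int CARD('p)}"
  unfolding of_int_of_int_mod_ring
  by (rule inj_on_inverseI[where g = to_int_mod_ring]) simp

text \<open>At most \<open>n\<close> residues are powers of \<open>a\<close>. The residue
  \<open>p - 1\<close>, missing from the range of \<open>s\<close>, represents -1 and is already one
  of them, so its omission costs nothing.\<close>

lemma card_scaling_factors:
  fixes a :: "'p::prime_card mod_ring"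
  assumes "mult_order a = n" "n > 0" "even n"
  defines "S \<equiv> {s \<in> {0..<int CARD('p) - 1}. of_int s \<notin> (\<lambda>i. a ^ i) ` {0..<n}}"
  shows "card S \<ge> CARD('p) - n" and "0 \<in> S"
proof -
  let ?p = "CARD('p)" and ?G = "(\<lambda>i. a ^ i) ` {0..<n}"
  let ?H = "{s \<in> {0..<int ?p}. (of_int s :: 'p mod_ring) \<in> ?G}"
  have "card ?H = card ((of_int :: int \<Rightarrow> 'p mod_ring) ` ?H)"
    by (intro card_image[symmetric] inj_on_subset[OF inj_on_of_int_mod_ring]) auto
  also have "\<dots> \<le> card ?G" by (intro card_mono) auto
  also have "\<dots> \<le> n" using card_image_le[of "{0..<n}"] by simp
  finally have "card ?H \<le> n" .
  moreover have "finite ?H" by (rule finite_subset[of _ "{0..<int ?p}"]) auto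
  ultimately have le: "?p - n \<le> card ({0..<int ?p} - ?H)"
    by (subst card_Diff_subset) auto
  have "{0..<int ?p} - ?H \<subseteq> S"
  proof
    fix s assume s: "s \<in> {0..<int ?p} - ?H"
    have "of_int (int ?p - 1) = (- 1 :: 'p mod_ring)"
      using of_nat_CHAR[where ?'a = "'p mod_ring"] by simp
    then have "of_int (int ?p - 1) \<in> ?G"
      using uminus_mem_powers[OF assms(1-3) one_mem_powers[OF assms(1-3)]] by simp
    then have "s \<noteq> int ?p - 1" using s by auto
    then show "s \<in> S" using s by (auto simp: S_def)
  qed
  moreover have "finite S" by (rule finite_subset[of _ "{0..<int ?p}"]) (auto simp: S_def)
  ultimately have "card ({0..<int ?p} - ?H) \<le> card S" by (intro card_mono)
  with le show "card S \<ge> ?p - n" by simp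
  have "a \<noteq> 0" using mult_orderD(1)[OF assms(1,2)] assms(2) by (auto simp: power_0_left)
  moreover have "?p > 1" by (rule nontriv)
  ultimately show "0 \<in> S" by (auto simp: S_def)
qed

theorem theorem3p4:
  fixes n p :: nat
  assumes "n \<ge> 2" and "even n" and "p = CARD('p::prime_card)"
  shows
    "(([int p = 1] (mod int n) \<or> [int p = -1] (mod int n)) \<and> p > n + 1 \<longrightarrow>
       (\<forall>c\<^sub>1 c\<^sub>2 :: 'p mod_ring.
          let f\<^sub>1 = map_poly of_int (chebyshev_T n) - [:c\<^sub>1:];
              f\<^sub>2 = map_poly of_int (chebyshev_T n) - [:c\<^sub>2:]
          in c\<^sub>1 \<noteq> c\<^sub>2 \<and> splits_completely f\<^sub>1 \<and> splits_completely f\<^sub>2 \<longrightarrow>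
             symmetric_ideal_PTE n (proots f\<^sub>1) (proots f\<^sub>2))) \<and>
     ([int p = 1] (mod int n) \<longrightarrow>
       (\<forall>a :: 'p mod_ring. mult_order a = n \<longrightarrow>
          (let r = (p - 1) div n;
               A = {#a ^ i. i \<in># mset_set {0..<n}#}
           in \<exists>S :: int set. S \<subseteq> {0..<int p - 1} \<and> card S = r \<and> 0 \<in> S \<and>
                (\<forall>s\<in>S. symmetric_ideal_PTE n A (scale_mset (of_int s) A)))))"
proof (intro conjI impI allI)
  fix c\<^sub>1 c\<^sub>2 :: "'p mod_ring"
  assume p: "([int p = 1] (mod int n) \<or> [int p = -1] (mod int n)) \<and> p > n + 1"
  let ?g = "map_poly of_int (chebyshev_T n) :: 'p mod_ring poly"
  obtain m where m: "n = Suc m" using \<open>n \<ge> 2\<close> by (cases n) auto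
  \<comment> \<open>From \<open>p > n + 1\<close> and \<open>n \<ge> 2\<close> the prime is odd, so
    the leading coefficient \<open>2 ^ (n - 1)\<close> is nonzero in the field.\<close>
  have "(2 :: 'p mod_ring) \<noteq> 0"
  proof
    assume "(2 :: 'p mod_ring) = 0"
    then have "of_nat 2 = (0 :: 'p mod_ring)" by simp
    then have "p dvd 2" unfolding of_nat_eq_0_iff_char_dvd assms(3) by simp
    then show False using p \<open>n \<ge> 2\<close> by (auto dest: dvd_imp_le)
  qed
  then have "coeff ?g n \<noteq> 0"
    unfolding m by (simp add: coeff_map_poly coeff_chebyshev_T_Suc)
  moreover have "degree ?g \<le> n"
    using degree_chebyshev_T_le[of n] degree_map_poly_le order.trans by blast
  ultimately have "degree ?g = n" by (simp add: le_degree order.antisym)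
  moreover have "pcompose ?g [:0, -1:] = map_poly of_int (pcompose (chebyshev_T n) [:0, -1:])"
    by (simp add: of_int_hom.map_poly_pcompose map_poly_pCons)
  then have "pcompose ?g [:0, -1:] = ?g"
    by (simp add: chebyshev_T_pcompose_uminus[OF \<open>even n\<close>])
  ultimately show "let f\<^sub>1 = map_poly of_int (chebyshev_T n) - [:c\<^sub>1:];
              f\<^sub>2 = map_poly of_int (chebyshev_T n) - [:c\<^sub>2:]
          in c\<^sub>1 \<noteq> c\<^sub>2 \<and> splits_completely f\<^sub>1 \<and> splits_completely f\<^sub>2 \<longrightarrow>
             symmetric_ideal_PTE n (proots f\<^sub>1) (proots f\<^sub>2)"
    using \<open>n \<ge> 2\<close> \<open>even n\<close> symmetric_ideal_PTE_proots[of n ?g c\<^sub>1 c\<^sub>2] by (simp add: Let_def)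
next
  fix a :: "'p mod_ring"
  assume cong: "[int p = 1] (mod int n)" and a: "mult_order a = n"
  let ?S = "{s \<in> {0..<int CARD('p) - 1}. of_int s \<notin> (\<lambda>i. a ^ i) ` {0..<n}}"
  define r where "r = (p - 1) div n"
  have "n > 0" using \<open>n \<ge> 2\<close> by simp
  note S = card_scaling_factors[OF a this \<open>even n\<close>]
  have "p > 1" unfolding assms(3) by (rule nontriv)
  have "int n dvd int p - 1" using cong by (simp add: cong_iff_dvd_diff)
  then have "n dvd p - 1" using \<open>p > 1\<close> by (metis int_dvd_int_iff int_ops(2) of_nat_diff less_imp_le)
  then have r: "p - 1 = r * n" by (simp add: r_def)
  then have "r > 0" using \<open>p > 1\<close> by (cases r) auto
  then obtain q where q: "r = Suc q" by (cases r) auto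
  obtain m where m: "n = Suc m" using \<open>n > 0\<close> by (cases n) auto
  \<comment> \<open>With \<open>r = q + 1\<close> this gives \<open>p - n = q * n + 1\<close>, which
    is at least \<open>q + 1\<close>.\<close>
  have "p = Suc (r * n)" using r \<open>p > 1\<close> by simp
  then have "r \<le> p - n" by (simp add: q m)
  \<comment> \<open>To obtain exactly \<open>r\<close> factors including 0, choose
    \<open>q = r - 1\<close> nonzero ones and then insert 0.\<close>
  then have "q \<le> card (?S - {0})" using S assms(3) q by simp
  then obtain T where T: "T \<subseteq> ?S - {0}" "card T = q" "finite T"
    by (rule obtain_subset_with_card_n)
  have "0 \<notin> T" using T(1) by blast
  then have "card (insert 0 T) = r" using T q by simp
  moreover have "insert 0 T \<subseteq> ?S" using T(1) S(2) by blast
  ultimately have "\<exists>S :: int set. S \<subseteq> {0..<int p - 1} \<and> card S = r \<and> 0 \<in> S \<and>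
      (\<forall>s\<in>S. symmetric_ideal_PTE n {#a ^ i. i \<in># mset_set {0..<n}#}
        (scale_mset (of_int s) {#a ^ i. i \<in># mset_set {0..<n}#}))"
    using symmetric_ideal_PTE_powers[OF a \<open>n > 0\<close> \<open>even n\<close>] unfolding assms(3)
    by (intro exI[of _ "insert 0 T"]) blast
  then show "let r = (p - 1) div n;
               A = {#a ^ i. i \<in># mset_set {0..<n}#}
           in \<exists>S :: int set. S \<subseteq> {0..<int p - 1} \<and> card S = r \<and> 0 \<in> S \<and>
                (\<forall>s\<in>S. symmetric_ideal_PTE n A (scale_mset (of_int s) A))"
    by (simp only: Let_def r_def)
qed

end
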